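(* Suppose assumptions (I)–(III) of the context hold, and let $\{(x_k,y_k)\}_{k\ge0}$ be the sequence generated by the CG-RPGA algorithm described in the context with step-sizes $\tau_k=\tau>0$ and $\sigma_k=\sigma\le\frac{2}{L_{yy}+2\mu}$ (with $\sigma>0$), and parameter $\mu>0$. Let $\rho=\max\{|1-\sigma(L_{yy}+\mu)|,\ |1-\sigma\mu|\}$. Then for any $K\ge1$ there exists $t\in\{\lceil K/2\rceil,\dots,K-1\}$ such that $(x_t,y_t)\in X\times Y$ satisfies the following bounds: $$\begin{aligned}\mathcal G_X(x_t,y_t)\le{}&\frac{2(f(x_0)-f(x_K))}{\tau K}+\frac{\mu}{\tau K}D_Y^2+\frac{2L_{yx}}{(1-\rho)K}D_X\|y_0-y^*_\mu(x_0)\|_2\\&+\Big(\frac{2L_{yx}^2\rho}{\mu(1-\rho)}+L_{xx}+\frac{L_{yx}^2}{\mu}\Big)\tau D_X^2\end{aligned}$$ and $$\mathcal G_Y(x_t,y_t)\le\frac{2\rho^{K/2}}{\sigma}\|y_0-y^*_\mu(x_0)\|_2+\frac{2L_{yx}\rho}{\sigma\mu(1-\rho)}\tau D_X+\frac{L_{yx}}{\sigma\mu}\tau D_X+\mu D_Y .$$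
   Context: Setting. $(\mathcal X,\|\cdot\|_{\mathcal X})$ is a finite-dimensional real normed space with dual norm $\|\cdot\|_{\mathcal X^*}$; $\mathcal Y$ is a finite-dimensional real space equipped with the Euclidean norm $\|\cdot\|_{\mathcal Y}=\|\cdot\|_2$, and projection onto $Y$ is assumed efficiently computable. The problem is $\min_{x\in X}\max_{y\in Y}\mathcal L(x,y)$ with $\mathcal L:\mathcal X\times\mathcal Y\to\mathbb R$. Assumptions. (I) For any $y\in Y$, $\mathcal L(\cdot,y)$ (possibly nonconvex) is continuously differentiable, and there are $L_{xx}\ge0$, $L_{yx}>0$ with $\|\nabla_x\mathcal L(x,y)-\nabla_x\mathcal L(\bar x,\bar y)\|_{\mathcal X^*}\le L_{xx}\|x-\bar x\|_{\mathcal X}+L_{yx}\|y-\bar y\|_2$ for all $x,\bar x\in X$, $y,\bar y\in Y$. (II) For any $x\in X$, $\mathcal L(x,\cdot)$ is concave and continuously differentiable, and there are $L_{yy}\ge0$, $L_{yx}>0$ with $\|\nabla_y\mathcal L(x,y)-\nabla_y\mathcal L(\bar x,\bar y)\|_2\le L_{yx}\|x-\bar x\|_{\mathcal X}+L_{yy}\|y-\bar y\|_2$ for all $x,\bar x\in X$, $y,\bar y\in Y$. (III) $X\subseteq\mathcal X$, $Y\subseteq\mathcal Y$ are convex compact sets with diameters $D_X=\sup_{x,\bar x\in X}\|x-\bar x\|_{\mathcal X}$, $D_Y=\sup_{y,\bar y\in Y}\|y-\bar y\|_2$. Notation. $f(x)=\max_{y\in Y}\mathcal L(x,y)$; $\mathcal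 L_\mu(x,y)=\mathcal L(x,y)-\frac{\mu}{2}\|y-y_0\|_2^2$; $y^*_\mu(x)=\operatorname{argmax}_{y\in Y}\mathcal L_\mu(x,y)$; $\mathcal P_Y$ is the Euclidean projection onto $Y$. Gap functions: $\mathcal G_X(\bar x,\bar y)=\sup_{x\in X}\langle\nabla_x\mathcal L(\bar x,\bar y),\bar x-x\rangle$ and $\mathcal G_Y(\bar x,\bar y)=\frac1\sigma\|\bar y-\mathcal P_Y(\bar y+\sigma\nabla_y\mathcal L(\bar x,\bar y))\|_2$, with $\sigma$ the dual step-size. CG-RPGA algorithm. Given $x_0\in X$, $y_0\in Y$, $\mu$, nonnegative step-sizes $\tau_k,\sigma_k$, for $k=0,1,\dots$: $s_k\in\operatorname{argmin}_{x\in X}\langle\nabla_x\mathcal L(x_k,y_k),x\rangle$; $x_{k+1}=\tau_ks_k+(1-\tau_k)x_k$; $y_{k+1}=\mathcal P_Y\big(y_k+\sigma_k(\nabla_y\mathcal L(x_k,y_k)-\mu(y_k-y_0))\big)$.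
   Formalization: As printed the claim is false (K=1: no t; K=2, L=xy: G_X bound fails; τ>1: iterates leave X). Proved for τ≤1, with t from ⌊K/2⌋ to K−1, ρ^⌊K/2⌋ in place of ρ^(K/2), and 2L_yx²/(μ(1−ρ)) in place of 2L_yx²ρ/(μ(1−ρ)) in the G_X bound. *)

theory Defs
  imports "HOL-Analysis.Analysis"
begin

text \<open>
  A linear functional on \<^typ>\<open>'a\<close> is an element of \<^typ>\<open>'a \<Rightarrow>\<^sub>L real\<close>, whose
  norm is the operator norm, i.e. the dual norm of the norm of \<^typ>\<open>'a\<close>.  The partial gradient
  in the first variable takes its values there, since that norm need not come from an inner product;
  the one in the second variable is the usual vector of the Euclidean space \<^typ>\<open>'b\<close>.
  The gradients are determined by the function at all points where they are required to be its
  derivatives.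
\<close>

definition is_grad_x ::
  "('a::real_normed_vector) set \<Rightarrow> 'b set \<Rightarrow> ('a \<Rightarrow> 'b \<Rightarrow> real) \<Rightarrow> ('a \<Rightarrow> 'b \<Rightarrow> ('a \<Rightarrow>\<^sub>L real)) \<Rightarrow> bool"
  where
  "is_grad_x X Y L Gx \<longleftrightarrow>
     (\<forall>x\<in>X. \<forall>y\<in>Y. ((\<lambda>u. L u y) has_derivative blinfun_apply (Gx x y)) (at x))"

definition is_grad_y ::
  "'a set \<Rightarrow> ('b::euclidean_space) set \<Rightarrow> ('a \<Rightarrow> 'b \<Rightarrow> real) \<Rightarrow> ('a \<Rightarrow> 'b \<Rightarrow> 'b) \<Rightarrow> bool"
  where
  "is_grad_y X Y L Gy \<longleftrightarrow>
     (\<forall>x\<in>X. \<forall>y\<in>Y. ((\<lambda>v. L x v) has_derivative (\<lambda>h. Gy x y \<bullet> h)) (at y))"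

definition primal_value :: "'b set \<Rightarrow> ('a \<Rightarrow> 'b \<Rightarrow> real) \<Rightarrow> 'a \<Rightarrow> real"
  where "primal_value Y L x = (SUP y\<in>Y. L x y)"

definition reg_lagrangian ::
  "('a \<Rightarrow> ('b::euclidean_space) \<Rightarrow> real) \<Rightarrow> real \<Rightarrow> 'b \<Rightarrow> 'a \<Rightarrow> 'b \<Rightarrow> real"
  where "reg_lagrangian L \<mu> y0 x y = L x y - \<mu> / 2 * (norm (y - y0))\<^sup>2"

definition reg_argmax ::
  "('b::euclidean_space) set \<Rightarrow> ('a \<Rightarrow> 'b \<Rightarrow> real) \<Rightarrow> real \<Rightarrow> 'b \<Rightarrow> 'a \<Rightarrow> 'b"
  where "reg_argmax Y L \<mu> y0 x = arg_max_on (reg_lagrangian L \<mu> y0 x) Y"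

definition gap_X ::
  "('a::real_normed_vector) set \<Rightarrow> ('a \<Rightarrow> 'b \<Rightarrow> ('a \<Rightarrow>\<^sub>L real)) \<Rightarrow> 'a \<Rightarrow> 'b \<Rightarrow> real"
  where "gap_X X Gx x y = (SUP z\<in>X. blinfun_apply (Gx x y) (x - z))"

definition gap_Y ::
  "('b::euclidean_space) set \<Rightarrow> ('a \<Rightarrow> 'b \<Rightarrow> 'b) \<Rightarrow> real \<Rightarrow> 'a \<Rightarrow> 'b \<Rightarrow> real"
  where "gap_Y Y Gy \<sigma> x y = 1 / \<sigma> * norm (y - closest_point Y (y + \<sigma> *\<^sub>R Gy x y))"

text \<open>
  The linear subproblem may have several solutions; \<open>s\<close> is any selection of them.
\<close>

definition cg_rpga ::
  "('a::real_normed_vector) set \<Rightarrow> ('b::euclidean_space) set \<Rightarrow>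
   ('a \<Rightarrow> 'b \<Rightarrow> ('a \<Rightarrow>\<^sub>L real)) \<Rightarrow> ('a \<Rightarrow> 'b \<Rightarrow> 'b) \<Rightarrow> real \<Rightarrow> (nat \<Rightarrow> real) \<Rightarrow> (nat \<Rightarrow> real) \<Rightarrow>
   (nat \<Rightarrow> 'a) \<Rightarrow> (nat \<Rightarrow> 'b) \<Rightarrow> bool"
  where
  "cg_rpga X Y Gx Gy \<mu> \<tau> \<sigma> x y \<longleftrightarrow>
     x 0 \<in> X \<and> y 0 \<in> Y \<and>
     (\<exists>s. \<forall>k.
        is_arg_min (blinfun_apply (Gx (x k) (y k))) (\<lambda>z. z \<in> X) (s k) \<and>
        x (Suc k) = \<tau> k *\<^sub>R s k + (1 - \<tau> k) *\<^sub>R x k \<and>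
        y (Suc k) = closest_point Y (y k + \<sigma> k *\<^sub>R (Gy (x k) (y k) - \<mu> *\<^sub>R (y k - y 0))))"

end

(*
  Let d_k be the distance from y_k to the maximizer ystar(x_k) of the mu-strongly concave regularized
  dual problem.  Since rho = 1 - sigma mu, the dual step contracts by rho towards ystar(x_k), and ystar
  is Lyx/mu-Lipschitz, so d_(k+1) <= rho d_k + c with c = Lyx tau D_X / mu.  This bounds the dual gap
  by (1 + rho) d_t / sigma + mu D_Y.  A Frank-Wolfe step changes the regularized primal value by at
  most -tau gap_X + tau Lyx D_X d_k + (Lxx + Lyx^2/mu) (tau D_X)^2 / 2; summing over all k < K and
  discarding the nonnegative gaps of the first half bounds the least gap of the second half.

  The gradient in y is Lipschitz on Y only, where the usual proof of cocoercivity fails; but the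
  contraction estimate is local, and locally in the relative interior that proof works.
*)
theory Submission
  imports Defs
begin

section \<open>One-variable calculus along segments\<close>

text \<open>Only difference quotients from the right are tested: along a segment of a convex set,
  the points with t < 0 may lie outside the set.\<close>

lemma le_has_real_derivative_at_0:
  fixes \<phi> :: "real \<Rightarrow> real"
  assumes "(\<phi> has_real_derivative D) (at 0)"
    and "\<And>t. 0 < t \<Longrightarrow> t \<le> 1 \<Longrightarrow> t * m \<le> \<phi> t - \<phi> 0"
  shows "m \<le> D"
proof (rule tendsto_lowerbound)
  have "((\<lambda>t. (\<phi> t - \<phi> 0) / (t - 0)) \<longlongrightarrow> D) (at 0)"
    using assms(1) by (simp add: has_field_derivative_iff)
  then show "((\<lambda>t. (\<phi> t - \<phi> 0) / t) \<longlongrightarrow> D) (at_right 0)"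
    by (auto intro: tendsto_mono[OF at_le])
  have "\<forall>\<^sub>F t in at_right 0. t \<in> {0<..<1::real}"
    by (rule eventually_at_right_real) simp
  then show "\<forall>\<^sub>F t in at_right 0. m \<le> (\<phi> t - \<phi> 0) / t"
  proof eventually_elim
    case (elim t)
    then show ?case using assms(2)[of t] by (simp add: field_simps)
  qed
qed simp

lemma has_real_derivative_along_line:
  assumes "(f has_derivative f') (at (u + t *\<^sub>R d))"
  shows "((\<lambda>t. f (u + t *\<^sub>R d)) has_real_derivative f' d) (at t)"
proof -
  have "((\<lambda>t. u + t *\<^sub>R d) has_derivative (\<lambda>h. h *\<^sub>R d)) (at t)"
    by (auto intro!: derivative_eq_intros)
  then have "((\<lambda>t. f (u + t *\<^sub>R d)) has_derivative (\<lambda>h. f' (h *\<^sub>R d))) (at t)"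
    using diff_chain_at[of "\<lambda>t. u + t *\<^sub>R d" _ t f f'] assms by (simp add: o_def)
  moreover have "(\<lambda>h. f' (h *\<^sub>R d)) = (*) (f' d)"
    using linear_scale[OF has_derivative_linear[OF assms]] by (simp add: fun_eq_iff)
  ultimately show ?thesis by (simp add: has_field_derivative_def)
qed

text \<open>Subtracting a t + b t^2 / 2 leaves a nonincreasing function, which replaces integration.
  The quadratic bounds in y and in x are both instances.\<close>

lemma increment_le_of_derivative_le_affine:
  fixes \<phi> :: "real \<Rightarrow> real"
  assumes "\<And>t. 0 \<le> t \<Longrightarrow> t \<le> 1 \<Longrightarrow> (\<phi> has_real_derivative \<phi>' t) (at t)"
    and "\<And>t. 0 \<le> t \<Longrightarrow> t \<le> 1 \<Longrightarrow> \<phi>' t \<le> a + b * t"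
  shows "\<phi> 1 - \<phi> 0 \<le> a + b / 2"
proof -
  have "\<phi> 1 - a * 1 - b / 2 * 1\<^sup>2 \<le> \<phi> 0 - a * 0 - b / 2 * 0\<^sup>2"
  proof (rule DERIV_nonpos_imp_nonincreasing[of 0 1 "\<lambda>t. \<phi> t - a * t - b / 2 * t\<^sup>2"])
    fix t :: real assume t: "0 \<le> t" "t \<le> 1"
    have "((\<lambda>t. \<phi> t - a * t - b / 2 * t\<^sup>2) has_real_derivative \<phi>' t - a - b * t) (at t)"
      using assms(1)[OF t] by (auto intro!: derivative_eq_intros)
    then show "\<exists>D. ((\<lambda>t. \<phi> t - a * t - b / 2 * t\<^sup>2) has_real_derivative D) (at t) \<and> D \<le> 0"
      using assms(2)[OF t] by (intro exI conjI) auto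
  qed simp
  then show ?thesis by simp
qed

lemma convex_mem_line:
  assumes "convex S" "u \<in> S" "u + d \<in> S" "0 \<le> t" "t \<le> (1::real)"
  shows "u + t *\<^sub>R d \<in> S"
  using convexD_alt[OF assms(1-5)] by (simp add: algebra_simps)

section \<open>Concave functions whose gradient is Lipschitz on the domain only\<close>

lemma concave_on_le_tangent:
  fixes f :: "'b::real_inner \<Rightarrow> real"
  assumes f: "concave_on S f" and S: "y \<in> S" "z \<in> S"
    and g: "(f has_derivative (\<lambda>h. g \<bullet> h)) (at y)"
  shows "f z \<le> f y + g \<bullet> (z - y)"
proof -
  have "((\<lambda>t. f (y + t *\<^sub>R (z - y))) has_real_derivative g \<bullet> (z - y)) (at 0)"
    by (rule has_real_derivative_along_line) (simp add: g)
  moreover have "t * (f z - f y) \<le> f (y + t *\<^sub>R (z - y)) - f (y + 0 *\<^sub>R (z - y))"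
    if t: "0 < t" "t \<le> 1" for t
  proof -
    have "(1 - t) * f y + t * f z \<le> f ((1 - t) *\<^sub>R y + t *\<^sub>R z)"
      using concave_onD[OF f, of t y z] S t by simp
    then show ?thesis by (simp add: algebra_simps)
  qed
  ultimately have "f z - f y \<le> g \<bullet> (z - y)" by (rule le_has_real_derivative_at_0)
  then show ?thesis by simp
qed

text \<open>Derivatives are taken in the whole space, but concavity and the Lipschitz bound are
  known on \<open>Y\<close> alone, so every test point below has to stay in \<open>Y\<close>, whose
  interior may be empty.\<close>

locale smooth_concave =
  fixes Y :: "'b::euclidean_space set" and \<psi> :: "'b \<Rightarrow> real" and g :: "'b \<Rightarrow> 'b" and l :: real
  assumes convex: "convex Y"
    and concave: "concave_on Y \<psi>"
    and grad: "\<And>v. v \<in> Y \<Longrightarrow> (\<psi> has_derivative (\<lambda>h. g v \<bullet> h)) (at v)"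
    and lipschitz: "\<And>v w. v \<in> Y \<Longrightarrow> w \<in> Y \<Longrightarrow> norm (g v - g w) \<le> l * norm (v - w)"
    and l: "0 \<le> l"
begin

lemma le_tangent: "v \<in> Y \<Longrightarrow> w \<in> Y \<Longrightarrow> \<psi> w \<le> \<psi> v + g v \<bullet> (w - v)"
  by (rule concave_on_le_tangent[OF concave _ _ grad])

lemma gradient_antimono:
  assumes "v \<in> Y" "w \<in> Y" shows "(g v - g w) \<bullet> (v - w) \<le> 0"
  using le_tangent[OF assms] le_tangent[OF assms(2,1)] by (simp add: inner_diff)

lemma quadratic_lower_bound:
  assumes v: "v \<in> Y" "v + d \<in> Y"
  shows "\<psi> v + g v \<bullet> d - l / 2 * (norm d)\<^sup>2 \<le> \<psi> (v + d)"
proof -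
  have in_Y: "v + t *\<^sub>R d \<in> Y" if "0 \<le> t" "t \<le> 1" for t
    using convex_mem_line[OF convex v that] .
  have "- \<psi> (v + 1 *\<^sub>R d) - - \<psi> (v + 0 *\<^sub>R d) \<le> - (g v \<bullet> d) + l * (norm d)\<^sup>2 / 2"
  proof (rule increment_le_of_derivative_le_affine)
    fix t :: real assume t: "0 \<le> t" "t \<le> 1"
    show "((\<lambda>t. - \<psi> (v + t *\<^sub>R d)) has_real_derivative - (g (v + t *\<^sub>R d) \<bullet> d)) (at t)"
      by (intro DERIV_minus has_real_derivative_along_line grad in_Y t)
    have "(g v - g (v + t *\<^sub>R d)) \<bullet> d \<le> norm (g v - g (v + t *\<^sub>R d)) * norm d"
      by (rule norm_cauchy_schwarz)
    also have "\<dots> \<le> l * norm (v - (v + t *\<^sub>R d)) * norm d"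
      by (intro mult_right_mono lipschitz in_Y t v(1)) simp
    finally show "- (g (v + t *\<^sub>R d) \<bullet> d) \<le> - (g v \<bullet> d) + l * (norm d)\<^sup>2 * t"
      using t by (simp add: inner_diff_left power2_eq_square mult_ac)
  qed
  then show ?thesis by simp
qed

text \<open>
  The Baillon--Haddad inequality needs test points off the segment from \<open>b\<close> to \<open>a\<close>, so it is
  only available here for points that are close compared to their distance from the relative
  boundary; \<open>u\<close> is the component of the gradient difference along the affine hull of \<open>Y\<close>.
\<close>

lemma cocoercive_local:
  assumes ab: "a \<in> Y" "b \<in> Y" and S: "subspace S" "u \<in> S"
    and near: "\<And>v. v \<in> S \<Longrightarrow> norm v \<le> norm (a - b) \<Longrightarrow> a + v \<in> Y \<and> b + v \<in> Y"
    and orth: "\<And>v. v \<in> S \<Longrightarrow> (g a - g b) \<bullet> v = u \<bullet> v"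
  shows "(norm u)\<^sup>2 \<le> l * ((g b - g a) \<bullet> (a - b))"
proof -
  have u_le: "norm u \<le> norm (g a - g b)"
  proof (cases "u = 0")
    case False
    have "norm u * norm u = (g a - g b) \<bullet> u"
      using orth[OF S(2)] by (simp add: norm_eq_sqrt_inner)
    also have "\<dots> \<le> norm (g a - g b) * norm u" by (rule norm_cauchy_schwarz)
    finally show ?thesis using False by simp
  qed simp
  show ?thesis
  proof (cases "l = 0")
    case True
    then have "norm (g a - g b) \<le> 0" using lipschitz[OF ab] by simp
    then show ?thesis using u_le True by simp
  next
    case False
    then have lpos: "0 < l" using l by simp
    \<comment> \<open>Among the w in \<open>S\<close> this one maximizes 2 (u . w) - l |w|^2, with
      value |u|^2 / l. The Lipschitz bound makes it no longer than a - b, the length that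
      \<open>near\<close> allows.\<close>
    define w where "w = (1 / l) *\<^sub>R u"
    have w: "w \<in> S" "- w \<in> S" using S by (auto simp: w_def subspace_scale subspace_neg)
    have "norm w \<le> norm (a - b)"
      using u_le lipschitz[OF ab] lpos by (simp add: w_def field_simps)
    then have in_Y: "a + w \<in> Y" "b + - w \<in> Y" using near[OF w(1)] near[OF w(2)] by auto
    \<comment> \<open>Each shifted point is bounded from below by the quadratic bound at its own
      base point and from above by the tangent at the other one; in the sum the values of \<psi>
      cancel.\<close>
    have "\<psi> b + g b \<bullet> (- w) - l / 2 * (norm w)\<^sup>2 \<le> \<psi> a + g a \<bullet> (b + - w - a)"
      using quadratic_lower_bound[OF ab(2) in_Y(2)] le_tangent[OF ab(1) in_Y(2)] by simp
    moreover have "\<psi> a + g a \<bullet> w - l / 2 * (norm w)\<^sup>2 \<le> \<psi> b + g b \<bullet> (a + w - b)"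
      using quadratic_lower_bound[OF ab(1) in_Y(1)] le_tangent[OF ab(2) in_Y(1)] by simp
    ultimately have "2 * ((g a - g b) \<bullet> w) - l * (norm w)\<^sup>2 \<le> (g b - g a) \<bullet> (a - b)"
      by (simp add: inner_simps)
    moreover have "(g a - g b) \<bullet> w = (norm u)\<^sup>2 / l"
      using orth[OF w(1)] by (simp add: w_def power2_norm_eq_inner)
    moreover have "l * (norm w)\<^sup>2 = (norm u)\<^sup>2 / l"
      using lpos by (simp add: w_def power2_eq_square)
    ultimately show ?thesis using lpos by (simp add: field_simps)
  qed
qed

text \<open>Expanding |\<alpha> (a - b) + \<sigma> u|^2 and inserting cocoercivity leaves the excess
  \<sigma> (2 \<alpha> - \<sigma> l) (u . (a - b)), which is at most 0. The part of g a - g b normal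
  to \<open>S\<close> is invisible to w. With \<alpha> = 1 - \<sigma> \<mu>, the condition on
  \<sigma> l is the step-size bound \<sigma> (l + 2 \<mu>) \<le> 2.\<close>

lemma gradient_step_local:
  assumes ab: "a \<in> Y" "b \<in> Y" and S: "subspace S" "a - b \<in> S" "w \<in> S"
    and near: "\<And>v. v \<in> S \<Longrightarrow> norm v \<le> norm (a - b) \<Longrightarrow> a + v \<in> Y \<and> b + v \<in> Y"
    and \<alpha>: "0 \<le> \<alpha>" "0 \<le> \<sigma>" "\<sigma> * l \<le> 2 * \<alpha>"
  shows "((\<alpha> *\<^sub>R a + \<sigma> *\<^sub>R g a) - (\<alpha> *\<^sub>R b + \<sigma> *\<^sub>R g b)) \<bullet> w \<le> \<alpha> * norm (a - b) * norm w"
proof -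
  have span: "span S = S" using S(1) by (simp add: span_eq_iff)
  obtain u n where u: "u \<in> S" and n: "\<And>v. v \<in> S \<Longrightarrow> orthogonal n v" and un: "g a - g b = u + n"
    using orthogonal_subspace_decomp_exists[of S "g a - g b"] unfolding span by metis
  have orth: "(g a - g b) \<bullet> v = u \<bullet> v" if "v \<in> S" for v
    using n[OF that] by (simp add: un inner_add_left orthogonal_def)
  have coco: "(norm u)\<^sup>2 \<le> - l * (u \<bullet> (a - b))"
  proof -
    have "(g b - g a) \<bullet> (a - b) = - ((g a - g b) \<bullet> (a - b))"
      by (metis inner_minus_left minus_diff_eq)
    moreover have "(norm u)\<^sup>2 \<le> l * ((g b - g a) \<bullet> (a - b))"
      by (rule cocoercive_local[OF ab S(1) u near orth])
    ultimately show ?thesis by (simp only: orth[OF S(2)] mult_minus_left mult_minus_right)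
  qed
  have mono: "u \<bullet> (a - b) \<le> 0"
    using gradient_antimono[OF ab] orth[OF S(2)] by simp
  have "(norm (\<alpha> *\<^sub>R v + \<sigma> *\<^sub>R u))\<^sup>2
      = \<alpha>\<^sup>2 * (norm v)\<^sup>2 + 2 * \<alpha> * \<sigma> * (u \<bullet> v) + \<sigma>\<^sup>2 * (norm u)\<^sup>2" for v
    unfolding power2_norm_eq_inner
    by (simp add: inner_add_left inner_add_right power2_eq_square inner_commute[of v u] algebra_simps)
  then have "(norm (\<alpha> *\<^sub>R (a - b) + \<sigma> *\<^sub>R u))\<^sup>2
      = \<alpha>\<^sup>2 * (norm (a - b))\<^sup>2 + 2 * \<alpha> * \<sigma> * (u \<bullet> (a - b)) + \<sigma>\<^sup>2 * (norm u)\<^sup>2" .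
  also have "\<dots> \<le> \<alpha>\<^sup>2 * (norm (a - b))\<^sup>2 + 2 * \<alpha> * \<sigma> * (u \<bullet> (a - b)) + \<sigma>\<^sup>2 * (- l * (u \<bullet> (a - b)))"
    using coco by (intro add_left_mono mult_left_mono) auto
  also have "\<dots> = \<alpha>\<^sup>2 * (norm (a - b))\<^sup>2 + \<sigma> * (2 * \<alpha> - \<sigma> * l) * (u \<bullet> (a - b))"
    by (simp add: power2_eq_square algebra_simps)
  also have "\<dots> \<le> (\<alpha> * norm (a - b))\<^sup>2"
    using mono \<alpha> by (simp add: power_mult_distrib mult_nonneg_nonpos)
  finally have le: "norm (\<alpha> *\<^sub>R (a - b) + \<sigma> *\<^sub>R u) \<le> \<alpha> * norm (a - b)"
    by (rule power2_le_imp_le) (use \<alpha> in simp)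
  have "(\<alpha> *\<^sub>R a + \<sigma> *\<^sub>R g a) - (\<alpha> *\<^sub>R b + \<sigma> *\<^sub>R g b) = \<alpha> *\<^sub>R (a - b) + \<sigma> *\<^sub>R (g a - g b)"
    by (simp add: scaleR_diff_right)
  then have "((\<alpha> *\<^sub>R a + \<sigma> *\<^sub>R g a) - (\<alpha> *\<^sub>R b + \<sigma> *\<^sub>R g b)) \<bullet> w = (\<alpha> *\<^sub>R (a - b)) \<bullet> w + \<sigma> * ((g a - g b) \<bullet> w)"
    by (simp only: inner_add_left inner_scaleR_left)
  also have "\<dots> = (\<alpha> *\<^sub>R (a - b) + \<sigma> *\<^sub>R u) \<bullet> w"
    using orth[OF S(3)] by (simp add: inner_add_left)
  also have "\<dots> \<le> norm (\<alpha> *\<^sub>R (a - b) + \<sigma> *\<^sub>R u) * norm w" by (rule norm_cauchy_schwarz)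
  also have "\<dots> \<le> \<alpha> * norm (a - b) * norm w" by (intro mult_right_mono le) simp
  finally show ?thesis .
qed

end

section \<open>From the local estimate to the contraction of projected gradient steps\<close>

text \<open>A uniform partition of mesh 1 / N < r is telescoped; bounds linear in t - s add up
  without loss.\<close>

lemma increment_le_of_local:
  fixes \<phi> :: "real \<Rightarrow> real"
  assumes r: "0 < r"
    and local: "\<And>s t. 0 \<le> s \<Longrightarrow> s \<le> t \<Longrightarrow> t \<le> 1 \<Longrightarrow> t - s < r \<Longrightarrow> \<phi> t - \<phi> s \<le> C * (t - s)"
  shows "\<phi> 1 - \<phi> 0 \<le> C"
proof -
  obtain N where N: "0 < N" "inverse (real N) < r"
    using ex_inverse_of_nat_less[OF r] by auto
  have "\<phi> (real i / N) - \<phi> 0 \<le> C * (real i / N)" if "i \<le> N" for i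
    using that
  proof (induction i)
    case (Suc i)
    have "\<phi> (real (Suc i) / N) - \<phi> (real i / N) \<le> C * (real (Suc i) / N - real i / N)"
      using Suc.prems N by (intro local) (auto simp: divide_simps)
    then show ?case using Suc by (simp add: algebra_simps)
  qed simp
  from this[of N] show ?thesis using N by simp
qed

context smooth_concave
begin

text \<open>
  Shrinking \<open>Y\<close> towards a relative interior point \<open>c\<close> makes room for the local estimate, which
  is then chained along the segment; letting the shrinking factor tend to one gives the claim.
\<close>

lemma gradient_step_inner_le:
  assumes ab: "a \<in> Y" "b \<in> Y" and pq: "p \<in> Y" "q \<in> Y"
    and \<alpha>: "0 \<le> \<alpha>" "0 \<le> \<sigma>" "\<sigma> * l \<le> 2 * \<alpha>"
  shows "((\<alpha> *\<^sub>R a + \<sigma> *\<^sub>R g a) - (\<alpha> *\<^sub>R b + \<sigma> *\<^sub>R g b)) \<bullet> (p - q) \<le> \<alpha> * norm (a - b) * norm (p - q)"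
proof -
  let ?E = "\<lambda>v. \<alpha> *\<^sub>R v + \<sigma> *\<^sub>R g v"
  obtain c where "c \<in> rel_interior Y"
    using rel_interior_eq_empty[OF convex] ab by blast
  then obtain e where e: "0 < e" "ball c e \<inter> affine hull Y \<subseteq> Y" and c: "c \<in> Y"
    by (auto simp: mem_rel_interior_ball)
  define S where "S = span ((\<lambda>x. x - c) ` Y)"
  have S: "subspace S" by (simp add: S_def)
  have diff_S: "v - w \<in> S" if "v \<in> Y" "w \<in> Y" for v w
  proof -
    have "v - c \<in> S" "w - c \<in> S" using that by (auto simp: S_def intro: span_base)
    then have "(v - c) - (w - c) \<in> S" using S by (rule subspace_diff[rotated])
    then show ?thesis by simp
  qed
  have c_ball: "c + v \<in> Y" if "v \<in> S" "norm v < e" for v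
  proof -
    have "c + v \<in> affine hull Y"
      using that(1) affine_hull_span_gen[OF hull_inc[OF c]] by (auto simp: S_def)
    then show ?thesis using e(2) that(2) by (auto simp: dist_norm)
  qed
  define shr where "shr \<epsilon> v = v + \<epsilon> *\<^sub>R (c - v)" for \<epsilon> :: real and v
  have shr_Y: "shr \<epsilon> v \<in> Y" if "v \<in> Y" "0 \<le> \<epsilon>" "\<epsilon> \<le> 1" for \<epsilon> v
    unfolding shr_def using convex_mem_line[OF convex, of v "c - v" \<epsilon>] that c by simp
  \<comment> \<open>The point lies on the segment from v to c + w / \<epsilon>, and the latter is in
    \<open>Y\<close> because |w / \<epsilon>| < e.\<close>
  have shr_ball: "shr \<epsilon> v + w \<in> Y" if "v \<in> Y" "0 < \<epsilon>" "\<epsilon> \<le> 1" "w \<in> S" "norm w < \<epsilon> * e" for \<epsilon> v w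
  proof -
    have "c + (1 / \<epsilon>) *\<^sub>R w \<in> Y"
      using that by (intro c_ball subspace_scale[OF S]) (auto simp: field_simps)
    then have "v + \<epsilon> *\<^sub>R (c + (1 / \<epsilon>) *\<^sub>R w - v) \<in> Y"
      using that by (intro convex_mem_line[OF convex]) auto
    then show ?thesis using that by (simp add: shr_def algebra_simps)
  qed
  have shrunk: "(?E (shr \<epsilon> a) - ?E (shr \<epsilon> b)) \<bullet> (p - q) \<le> \<alpha> * norm (shr \<epsilon> a - shr \<epsilon> b) * norm (p - q)"
    if \<epsilon>: "0 < \<epsilon>" "\<epsilon> \<le> 1" for \<epsilon>
  proof -
    define d where "d = shr \<epsilon> a - shr \<epsilon> b"
    define pt where "pt t = shr \<epsilon> (b + t *\<^sub>R (a - b))" for t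
    have pt_diff: "pt t - pt s = (t - s) *\<^sub>R d" for s t
      by (simp add: pt_def shr_def d_def algebra_simps)
    have seg: "b + t *\<^sub>R (a - b) \<in> Y" if "0 \<le> t" "t \<le> 1" for t
      using convex_mem_line[OF convex, of b "a - b" t] ab that by simp
    \<comment> \<open>Parameters closer than r give points closer than \<epsilon> e; the summand 1
      covers the case d = 0.\<close>
    define r where "r = \<epsilon> * e / (1 + norm d)"
    have r: "0 < r"
      unfolding r_def using \<epsilon> e by (intro divide_pos_pos mult_pos_pos) (auto simp: add_pos_nonneg)
    \<comment> \<open>The test vector p - q is the same on every piece and distances add up along a
      segment, so the local bounds chain to the global one with the same constant.\<close>
    have "?E (pt 1) \<bullet> (p - q) - ?E (pt 0) \<bullet> (p - q) \<le> \<alpha> * norm d * norm (p - q)"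
    proof (rule increment_le_of_local[OF r])
      fix s t :: real assume st: "0 \<le> s" "s \<le> t" "t \<le> 1" "t - s < r"
      have small: "norm (pt t - pt s) < \<epsilon> * e"
      proof -
        have "norm (pt t - pt s) \<le> (t - s) * (1 + norm d)"
          using st by (simp add: pt_diff mult_left_mono)
        also have "\<dots> < r * (1 + norm d)"
          using st by (intro mult_strict_right_mono) (auto simp: add_pos_nonneg)
        also have "\<dots> = \<epsilon> * e" by (simp add: r_def add_pos_nonneg add_nonneg_eq_0_iff)
        finally show ?thesis .
      qed
      have in_Y: "pt s \<in> Y" "pt t \<in> Y" using st \<epsilon> by (auto simp: pt_def intro!: shr_Y seg)
      have "(?E (pt t) - ?E (pt s)) \<bullet> (p - q) \<le> \<alpha> * norm (pt t - pt s) * norm (p - q)"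
      proof (rule gradient_step_local[OF in_Y(2,1) S diff_S[OF in_Y(2,1)] diff_S[OF pq] _ \<alpha>])
        fix v assume "v \<in> S" "norm v \<le> norm (pt t - pt s)"
        then show "pt t + v \<in> Y \<and> pt s + v \<in> Y"
          using small st \<epsilon> unfolding pt_def by (auto intro!: shr_ball seg)
      qed
      then show "?E (pt t) \<bullet> (p - q) - ?E (pt s) \<bullet> (p - q) \<le> \<alpha> * norm d * norm (p - q) * (t - s)"
        using st by (simp add: inner_diff_left pt_diff mult_ac)
    qed
    then show ?thesis by (simp add: pt_def d_def inner_diff_left)
  qed
  have "l-lipschitz_on Y g" using lipschitz l by (auto intro!: lipschitz_onI simp: dist_norm)
  then have g_cont: "continuous_on Y g" by (rule lipschitz_on_continuous_on)
  have shr_lim: "((\<lambda>\<epsilon>. shr \<epsilon> v) \<longlongrightarrow> v) (at_right 0)" for v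
    unfolding shr_def by (auto intro!: tendsto_eq_intros)
  have small: "\<forall>\<^sub>F \<epsilon> in at_right 0. \<epsilon> \<in> {0<..<1::real}"
    by (rule eventually_at_right_real) simp
  have g_lim: "((\<lambda>\<epsilon>. g (shr \<epsilon> v)) \<longlongrightarrow> g v) (at_right 0)" if v: "v \<in> Y" for v
  proof (rule continuous_on_tendsto_compose[OF g_cont shr_lim v])
    show "\<forall>\<^sub>F \<epsilon> in at_right 0. shr \<epsilon> v \<in> Y"
      using small by eventually_elim (auto intro: shr_Y v)
  qed
  show ?thesis
  proof (rule tendsto_le)
    show "((\<lambda>\<epsilon>. (?E (shr \<epsilon> a) - ?E (shr \<epsilon> b)) \<bullet> (p - q)) \<longlongrightarrow> (?E a - ?E b) \<bullet> (p - q)) (at_right 0)"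
      by (intro tendsto_intros shr_lim g_lim ab)
    show "((\<lambda>\<epsilon>. \<alpha> * norm (shr \<epsilon> a - shr \<epsilon> b) * norm (p - q)) \<longlongrightarrow> \<alpha> * norm (a - b) * norm (p - q)) (at_right 0)"
      by (intro tendsto_intros shr_lim)
    show "\<forall>\<^sub>F \<epsilon> in at_right 0. (?E (shr \<epsilon> a) - ?E (shr \<epsilon> b)) \<bullet> (p - q) \<le> \<alpha> * norm (shr \<epsilon> a - shr \<epsilon> b) * norm (p - q)"
      using small by eventually_elim (auto intro: shrunk)
  qed simp
qed

text \<open>The variational inequalities of the two projections add up to |p - q|^2 \<le>
  (\<open>?u\<close> - \<open>?v\<close>) . (p - q). Hence the gradient step is tested only along a
  difference of two points of \<open>Y\<close>, where \<open>gradient_step_inner_le\<close>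
  applies.\<close>

lemma projected_gradient_step_contraction:
  assumes "closed Y" and ab: "a \<in> Y" "b \<in> Y"
    and \<alpha>: "0 \<le> \<alpha>" "0 \<le> \<sigma>" "\<sigma> * l \<le> 2 * \<alpha>"
  shows "norm (closest_point Y (\<alpha> *\<^sub>R a + \<sigma> *\<^sub>R g a + z) - closest_point Y (\<alpha> *\<^sub>R b + \<sigma> *\<^sub>R g b + z))
    \<le> \<alpha> * norm (a - b)"
proof -
  let ?u = "\<alpha> *\<^sub>R a + \<sigma> *\<^sub>R g a" and ?v = "\<alpha> *\<^sub>R b + \<sigma> *\<^sub>R g b"
  define p where "p = closest_point Y (?u + z)"
  define q where "q = closest_point Y (?v + z)"
  have pq: "p \<in> Y" "q \<in> Y"
    unfolding p_def q_def using assms by (auto intro: closest_point_in_set)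
  have "(?u + z - p) \<bullet> (q - p) \<le> 0" "(?v + z - q) \<bullet> (p - q) \<le> 0"
    unfolding p_def q_def using assms pq[unfolded p_def q_def] convex
    by (auto intro!: closest_point_dot)
  then have "(p - q) \<bullet> (p - q) \<le> (?u - ?v) \<bullet> (p - q)"
    by (simp add: inner_diff inner_add_left)
  also have "\<dots> \<le> \<alpha> * norm (a - b) * norm (p - q)"
    by (rule gradient_step_inner_le[OF ab pq \<alpha>])
  finally have "norm (p - q) * norm (p - q) \<le> \<alpha> * norm (a - b) * norm (p - q)"
    by (simp add: norm_eq_sqrt_inner)
  then have "norm (p - q) \<le> \<alpha> * norm (a - b)"
    using \<alpha> by (cases "p = q") auto
  then show ?thesis by (simp add: p_def q_def)
qed

end

section \<open>The regularized dual problem and its maximizer\<close>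

locale regularized_saddle =
  fixes X :: "'a::real_normed_vector set" and Y :: "'b::euclidean_space set"
    and L :: "'a \<Rightarrow> 'b \<Rightarrow> real"
    and Gx :: "'a \<Rightarrow> 'b \<Rightarrow> ('a \<Rightarrow>\<^sub>L real)" and Gy :: "'a \<Rightarrow> 'b \<Rightarrow> 'b"
    and Lxx Lyx Lyy \<mu> :: real and y0 :: 'b
  assumes convex_X: "convex X" and convex_Y: "convex Y" and compact_Y: "compact Y"
    and const_nonneg: "0 \<le> Lxx" "0 \<le> Lyx" "0 \<le> Lyy"
    and grad_x: "is_grad_x X Y L Gx"
    and grad_x_lipschitz:
      "\<And>u u' v v'. u \<in> X \<Longrightarrow> u' \<in> X \<Longrightarrow> v \<in> Y \<Longrightarrow> v' \<in> Y \<Longrightarrow>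
         norm (Gx u v - Gx u' v') \<le> Lxx * norm (u - u') + Lyx * norm (v - v')"
    and concave: "\<And>u. u \<in> X \<Longrightarrow> concave_on Y (L u)"
    and grad_y: "is_grad_y X Y L Gy"
    and grad_y_lipschitz:
      "\<And>u u' v v'. u \<in> X \<Longrightarrow> u' \<in> X \<Longrightarrow> v \<in> Y \<Longrightarrow> v' \<in> Y \<Longrightarrow>
         norm (Gy u v - Gy u' v') \<le> Lyx * norm (u - u') + Lyy * norm (v - v')"
    and mu: "0 < \<mu>"
    and y0: "y0 \<in> Y"
begin

abbreviation ystar :: "'a \<Rightarrow> 'b" where "ystar \<equiv> reg_argmax Y L \<mu> y0"

abbreviation reg :: "'a \<Rightarrow> 'b \<Rightarrow> real" where "reg \<equiv> reg_lagrangian L \<mu> y0"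

lemma Y_diameter: "v \<in> Y \<Longrightarrow> w \<in> Y \<Longrightarrow> norm (v - w) \<le> diameter Y"
  using diameter_bounded_bound[OF compact_imp_bounded[OF compact_Y]] by (simp add: dist_norm)

lemma closest_point_mem: "closest_point Y v \<in> Y"
  using closest_point_in_set[OF compact_imp_closed[OF compact_Y]] y0 by auto

lemma smooth_concave_section: "u \<in> X \<Longrightarrow> smooth_concave Y (L u) (Gy u) Lyy"
  using convex_Y concave grad_y grad_y_lipschitz[of u u] const_nonneg
  by unfold_locales (auto simp: is_grad_y_def)

lemma continuous_section: "u \<in> X \<Longrightarrow> continuous_on Y (L u)"
  using grad_y unfolding is_grad_y_def
  by (intro continuous_at_imp_continuous_on ballI) (metis has_derivative_continuous)

text \<open>\<open>reg_argmax\<close> is a choice operator, so a maximizer must first be shown to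
  exist; compactness of \<open>Y\<close> and continuity supply it.\<close>

lemma ystar_maximal:
  assumes u: "u \<in> X"
  shows "ystar u \<in> Y" and "v \<in> Y \<Longrightarrow> reg u v \<le> reg u (ystar u)"
proof -
  have "continuous_on Y (reg u)"
    unfolding reg_lagrangian_def by (intro continuous_intros continuous_section u)
  then obtain w where "w \<in> Y" "\<forall>v\<in>Y. reg u v \<le> reg u w"
    using continuous_attains_sup[OF compact_Y] y0 by blast
  then have "is_arg_max (reg u) (\<lambda>v. v \<in> Y) w"
    by (auto simp: is_arg_max_linorder)
  then have "is_arg_max (reg u) (\<lambda>v. v \<in> Y) (ystar u)"
    unfolding reg_argmax_def arg_max_on_def arg_max_def by (rule someI)
  then show "ystar u \<in> Y" "v \<in> Y \<Longrightarrow> reg u v \<le> reg u (ystar u)"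
    by (auto simp: is_arg_max_linorder)
qed

text \<open>Along the segment towards v, which stays in \<open>Y\<close>, the negative of
  \<open>reg u\<close> starts at a minimum, so its slope there is nonnegative.\<close>

lemma ystar_optimality:
  assumes u: "u \<in> X" and v: "v \<in> Y"
  shows "(Gy u (ystar u) - \<mu> *\<^sub>R (ystar u - y0)) \<bullet> (v - ystar u) \<le> 0"
proof -
  let ?d = "v - ystar u" and ?g = "Gy u (ystar u) - \<mu> *\<^sub>R (ystar u - y0)"
  note ys = ystar_maximal[OF u]
  have "((\<lambda>w. - reg u w) has_derivative (\<lambda>h. - (?g \<bullet> h))) (at (ystar u))"
    unfolding reg_lagrangian_def power2_norm_eq_inner
    using grad_y[unfolded is_grad_y_def, rule_format, OF u ys(1)]
    by (auto intro!: derivative_eq_intros simp: inner_simps inner_commute algebra_simps)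
  then have "((\<lambda>t. - reg u (ystar u + t *\<^sub>R ?d)) has_real_derivative - (?g \<bullet> ?d)) (at 0)"
    by (intro has_real_derivative_along_line[where f' = "\<lambda>h. - (?g \<bullet> h)"]) simp
  moreover have "t * 0 \<le> - reg u (ystar u + t *\<^sub>R ?d) - - reg u (ystar u + 0 *\<^sub>R ?d)"
    if "0 < t" "t \<le> 1" for t
    using ys(2)[OF convex_mem_line[OF convex_Y ys(1), of ?d t]] v that by simp
  ultimately have "0 \<le> - (?g \<bullet> ?d)" by (rule le_has_real_derivative_at_0)
  then show ?thesis by simp
qed

text \<open>The concave part \<open>L u\<close> lies below its tangent and the quadratic part is
  expanded exactly; the first-order terms together have the sign given by
  \<open>ystar_optimality\<close>.\<close>

lemma ystar_quadratic_growth: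
  assumes u: "u \<in> X" and v: "v \<in> Y"
  shows "reg u v + \<mu> / 2 * (norm (v - ystar u))\<^sup>2 \<le> reg u (ystar u)"
proof -
  interpret smooth_concave Y "L u" "Gy u" Lyy by (rule smooth_concave_section[OF u])
  have "L u v \<le> L u (ystar u) + \<mu> * ((ystar u - y0) \<bullet> (v - ystar u))"
    using le_tangent[OF ystar_maximal(1)[OF u] v] ystar_optimality[OF u v]
    by (simp add: inner_diff_left)
  moreover have "(norm (v - y0))\<^sup>2
      = (norm (ystar u - y0))\<^sup>2 + 2 * ((ystar u - y0) \<bullet> (v - ystar u)) + (norm (v - ystar u))\<^sup>2"
    unfolding power2_norm_eq_inner by (simp add: inner_simps inner_commute)
  then have "\<mu> / 2 * (norm (v - y0))\<^sup>2 = \<mu> / 2 * (norm (ystar u - y0))\<^sup>2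
      + \<mu> * ((ystar u - y0) \<bullet> (v - ystar u)) + \<mu> / 2 * (norm (v - ystar u))\<^sup>2"
    by (simp add: distrib_left)
  ultimately show ?thesis unfolding reg_lagrangian_def by linarith
qed

text \<open>The optimality conditions of the two maximizers, each tested at the other, are added.
  Concavity of \<open>L u\<close> reduces the rest to a gradient difference at a single dual point,
  so only \<open>Lyx\<close> enters.\<close>

lemma ystar_lipschitz:
  assumes u: "u \<in> X" "u' \<in> X"
  shows "norm (ystar u - ystar u') \<le> Lyx / \<mu> * norm (u - u')"
proof -
  interpret smooth_concave Y "L u" "Gy u" Lyy by (rule smooth_concave_section[OF u(1)])
  let ?a = "ystar u" and ?b = "ystar u'"
  have Y: "?a \<in> Y" "?b \<in> Y" using u by (auto intro: ystar_maximal)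
  have "\<mu> * ((?a - ?b) \<bullet> (?a - ?b)) \<le> (Gy u ?b - Gy u' ?b) \<bullet> (?a - ?b)"
    using ystar_optimality[OF u(1) Y(2)] ystar_optimality[OF u(2) Y(1)] gradient_antimono[OF Y]
    by (simp add: inner_simps inner_commute algebra_simps)
  also have "\<dots> \<le> norm (Gy u ?b - Gy u' ?b) * norm (?a - ?b)" by (rule norm_cauchy_schwarz)
  also have "\<dots> \<le> Lyx * norm (u - u') * norm (?a - ?b)"
    using grad_y_lipschitz[OF u Y(2) Y(2)] by (intro mult_right_mono) auto
  finally have "\<mu> * norm (?a - ?b) * norm (?a - ?b) \<le> Lyx * norm (u - u') * norm (?a - ?b)"
    by (simp add: norm_eq_sqrt_inner mult.assoc)
  then have "\<mu> * norm (?a - ?b) \<le> Lyx * norm (u - u')"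
    using const_nonneg by (cases "?a = ?b") auto
  then show ?thesis using mu by (simp add: field_simps)
qed

text \<open>The optimality condition is the variational characterization of this projection: in the
  expanded square the mixed term can only increase the distance to other points of
  \<open>Y\<close>.\<close>

lemma ystar_fixed_point:
  assumes u: "u \<in> X" and \<sigma>: "0 < \<sigma>"
  shows "closest_point Y (ystar u + \<sigma> *\<^sub>R (Gy u (ystar u) - \<mu> *\<^sub>R (ystar u - y0))) = ystar u"
proof (rule closest_point_unique[symmetric])
  let ?g = "Gy u (ystar u) - \<mu> *\<^sub>R (ystar u - y0)"
  show "\<forall>z\<in>Y. dist (ystar u + \<sigma> *\<^sub>R ?g) (ystar u) \<le> dist (ystar u + \<sigma> *\<^sub>R ?g) z"
  proof
    fix z assume z: "z \<in> Y"
    have "\<sigma> * (?g \<bullet> (z - ystar u)) \<le> 0"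
      using ystar_optimality[OF u z] \<sigma> by (simp add: mult_nonneg_nonpos)
    then have "\<sigma> * (?g \<bullet> (z - ystar u)) * 2 \<le> (norm (z - ystar u))\<^sup>2"
      using zero_le_power2[of "norm (z - ystar u)"] by linarith
    then have "(norm (\<sigma> *\<^sub>R ?g))\<^sup>2 \<le> (norm (\<sigma> *\<^sub>R ?g))\<^sup>2 - 2 * \<sigma> * (?g \<bullet> (z - ystar u)) + (norm (z - ystar u))\<^sup>2"
      by (simp add: mult_ac)
    also have "\<dots> = (norm (\<sigma> *\<^sub>R ?g - (z - ystar u)))\<^sup>2"
      unfolding power2_norm_eq_inner inner_diff_left[of "\<sigma> *\<^sub>R ?g"] inner_diff_right[of _ "\<sigma> *\<^sub>R ?g"]
      by (simp add: inner_commute)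
    finally have "norm (\<sigma> *\<^sub>R ?g) \<le> norm (\<sigma> *\<^sub>R ?g - (z - ystar u))"
      by (rule power2_le_imp_le) simp
    then show "dist (ystar u + \<sigma> *\<^sub>R ?g) (ystar u) \<le> dist (ystar u + \<sigma> *\<^sub>R ?g) z"
      by (simp add: dist_norm algebra_simps)
  qed
qed (use convex_Y compact_Y ystar_maximal[OF u] in \<open>auto intro: compact_imp_closed\<close>)

text \<open>Since \<open>ystar u\<close> is a fixed point of the step, both points are images under
  one projected map, with \<alpha> = 1 - \<sigma> \<mu> and common shift \<sigma> \<mu> y0.\<close>

lemma dual_step_contraction:
  assumes u: "u \<in> X" and v: "v \<in> Y" and \<sigma>: "0 < \<sigma>" "\<sigma> * (Lyy + 2 * \<mu>) \<le> 2"
  shows "norm (closest_point Y (v + \<sigma> *\<^sub>R (Gy u v - \<mu> *\<^sub>R (v - y0))) - ystar u)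
    \<le> (1 - \<sigma> * \<mu>) * norm (v - ystar u)"
proof -
  interpret smooth_concave Y "L u" "Gy u" Lyy by (rule smooth_concave_section[OF u])
  have split: "w + \<sigma> *\<^sub>R (Gy u w - \<mu> *\<^sub>R (w - y0)) = (1 - \<sigma> * \<mu>) *\<^sub>R w + \<sigma> *\<^sub>R Gy u w + (\<sigma> * \<mu>) *\<^sub>R y0" for w
    by (simp add: algebra_simps)
  have "0 \<le> \<sigma> * Lyy" using \<sigma> const_nonneg by simp
  then have "norm (closest_point Y ((1 - \<sigma> * \<mu>) *\<^sub>R v + \<sigma> *\<^sub>R Gy u v + (\<sigma> * \<mu>) *\<^sub>R y0)
      - closest_point Y ((1 - \<sigma> * \<mu>) *\<^sub>R ystar u + \<sigma> *\<^sub>R Gy u (ystar u) + (\<sigma> * \<mu>) *\<^sub>R y0))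
      \<le> (1 - \<sigma> * \<mu>) * norm (v - ystar u)"
    using \<sigma> by (intro projected_gradient_step_contraction compact_imp_closed compact_Y v ystar_maximal(1) u)
      (auto simp: algebra_simps)
  then show ?thesis
    using ystar_fixed_point[OF u \<sigma>(1)] by (simp add: split)
qed

section \<open>Descent of the regularized primal value\<close>

text \<open>The algorithm knows the gradient at the dual iterate v, while the increment is needed at
  a maximizer w; this mismatch costs the \<open>Lyx\<close> term.\<close>

lemma primal_increment_le:
  assumes u: "u \<in> X" "u + d \<in> X" and v: "v \<in> Y" "w \<in> Y"
  shows "L (u + d) w - L u w \<le> Gx u v d + Lyx * norm (w - v) * norm d + Lxx / 2 * (norm d)\<^sup>2"
proof -
  have in_X: "u + t *\<^sub>R d \<in> X" if "0 \<le> t" "t \<le> 1" for t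
    using convex_mem_line[OF convex_X u that] .
  have "L (u + 1 *\<^sub>R d) w - L (u + 0 *\<^sub>R d) w
      \<le> (Gx u v d + Lyx * norm (w - v) * norm d) + Lxx * (norm d)\<^sup>2 / 2"
  proof (rule increment_le_of_derivative_le_affine)
    fix t :: real assume t: "0 \<le> t" "t \<le> 1"
    show "((\<lambda>t. L (u + t *\<^sub>R d) w) has_real_derivative Gx (u + t *\<^sub>R d) w d) (at t)"
      using grad_x in_X[OF t] v(2) unfolding is_grad_x_def
      by (intro has_real_derivative_along_line[of "\<lambda>u. L u w"]) auto
    have "Gx (u + t *\<^sub>R d) w d - Gx u v d \<le> norm (Gx (u + t *\<^sub>R d) w - Gx u v) * norm d"
      using norm_blinfun[of "Gx (u + t *\<^sub>R d) w - Gx u v" d] by (simp add: blinfun.diff_left)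
    also have "\<dots> \<le> (Lxx * norm (u + t *\<^sub>R d - u) + Lyx * norm (w - v)) * norm d"
      by (intro mult_right_mono grad_x_lipschitz in_X t u v) simp
    finally show "Gx (u + t *\<^sub>R d) w d \<le> (Gx u v d + Lyx * norm (w - v) * norm d) + Lxx * (norm d)\<^sup>2 * t"
      using t by (simp add: power2_eq_square algebra_simps)
  qed
  then show ?thesis by simp
qed

text \<open>
  The growth of the regularized dual problem around its solution pays for replacing the maximizer
  at \<open>u + d\<close> by the one at \<open>u\<close>, so differentiability of the maximum in \<open>u\<close> is never used.
\<close>

lemma reg_value_increment_le:
  assumes u: "u \<in> X" "u + d \<in> X" and v: "v \<in> Y"
  shows "reg (u + d) (ystar (u + d)) - reg u (ystar u)
    \<le> Gx u v d + Lyx * norm (v - ystar u) * norm d + (Lxx + Lyx\<^sup>2 / \<mu>) / 2 * (norm d)\<^sup>2"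
proof -
  let ?w = "ystar (u + d)"
  define e where "e = norm (?w - ystar u)"
  have w: "?w \<in> Y" using u by (intro ystar_maximal)
  have tri: "norm (?w - v) \<le> e + norm (v - ystar u)"
    using norm_triangle_ineq4[of "?w - ystar u" "v - ystar u"] by (simp add: e_def)
  \<comment> \<open>Young's inequality, weighted so that its e^2 part is exactly what quadratic
    growth returns; the rest is the Lyx^2 / \<mu> part of the final constant.\<close>
  have "0 \<le> (\<mu> * e - Lyx * norm d)\<^sup>2" by simp
  then have "Lyx * e * norm d \<le> (\<mu>\<^sup>2 * e\<^sup>2 + Lyx\<^sup>2 * (norm d)\<^sup>2) / (2 * \<mu>)"
    using mu by (simp add: pos_le_divide_eq power2_diff power_mult_distrib mult_ac)
  also have "\<dots> = \<mu> / 2 * e\<^sup>2 + Lyx\<^sup>2 / \<mu> / 2 * (norm d)\<^sup>2"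
    using mu by (simp add: field_simps power2_eq_square)
  finally have young: "Lyx * e * norm d \<le> \<mu> / 2 * e\<^sup>2 + Lyx\<^sup>2 / \<mu> / 2 * (norm d)\<^sup>2" .
  have "reg (u + d) ?w - reg u (ystar u) \<le> L (u + d) ?w - L u ?w - \<mu> / 2 * e\<^sup>2"
    using ystar_quadratic_growth[OF u(1) w] by (simp add: reg_lagrangian_def e_def)
  also have "\<dots> \<le> Gx u v d + Lyx * norm (?w - v) * norm d + Lxx / 2 * (norm d)\<^sup>2 - \<mu> / 2 * e\<^sup>2"
    using primal_increment_le[OF u v w] by simp
  also have "\<dots> \<le> Gx u v d + Lyx * (e + norm (v - ystar u)) * norm d + Lxx / 2 * (norm d)\<^sup>2 - \<mu> / 2 * e\<^sup>2"
    using mult_right_mono[OF mult_left_mono[OF tri const_nonneg(2)] norm_ge_zero[of d]] by simp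
  also have "\<dots> \<le> Gx u v d + Lyx * norm (v - ystar u) * norm d + (Lxx + Lyx\<^sup>2 / \<mu>) / 2 * (norm d)\<^sup>2"
    using young by (simp add: algebra_simps add_divide_distrib)
  finally show ?thesis .
qed

section \<open>Comparison with the unregularized value and with the dual gap\<close>

text \<open>In the telescoped sum this bound serves at the first iterate and the next lemma at the
  last one, so the regularization error \<mu> / 2 D_Y^2 is paid only once.\<close>

lemma reg_value_le_primal_value:
  assumes u: "u \<in> X" shows "reg u (ystar u) \<le> primal_value Y L u"
proof -
  have "bdd_above (L u ` Y)"
    by (intro bounded_imp_bdd_above compact_imp_bounded compact_continuous_image continuous_section u compact_Y)
  then have "L u (ystar u) \<le> primal_value Y L u"
    unfolding primal_value_def by (intro cSUP_upper ystar_maximal(1)[OF u])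
  moreover have "reg u (ystar u) \<le> L u (ystar u)" using mu by (simp add: reg_lagrangian_def)
  ultimately show ?thesis by simp
qed

lemma primal_value_le_reg_value:
  assumes u: "u \<in> X" shows "primal_value Y L u \<le> reg u (ystar u) + \<mu> / 2 * (diameter Y)\<^sup>2"
  unfolding primal_value_def
proof (rule cSUP_least)
  show "Y \<noteq> {}" using y0 by auto
  fix v assume v: "v \<in> Y"
  have "(norm (v - y0))\<^sup>2 \<le> (diameter Y)\<^sup>2" by (intro power_mono Y_diameter v y0) simp
  then have "\<mu> / 2 * (norm (v - y0))\<^sup>2 \<le> \<mu> / 2 * (diameter Y)\<^sup>2" using mu by simp
  then show "L u v \<le> reg u (ystar u) + \<mu> / 2 * (diameter Y)\<^sup>2"
    using ystar_maximal(2)[OF u v] by (simp add: reg_lagrangian_def)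
qed

text \<open>The unregularized step q is compared with the regularized step p: projections are
  nonexpansive, so they differ by at most \<sigma> \<mu> |v - y0|. Passing from v to p through
  \<open>ystar u\<close> costs the factor 1 + (1 - \<sigma> \<mu>).\<close>

lemma gap_Y_le:
  assumes u: "u \<in> X" and v: "v \<in> Y" and \<sigma>: "0 < \<sigma>" "\<sigma> * (Lyy + 2 * \<mu>) \<le> 2"
  shows "gap_Y Y Gy \<sigma> u v \<le> (2 - \<sigma> * \<mu>) / \<sigma> * norm (v - ystar u) + \<mu> * diameter Y"
proof -
  define p where "p = closest_point Y (v + \<sigma> *\<^sub>R (Gy u v - \<mu> *\<^sub>R (v - y0)))"
  define q where "q = closest_point Y (v + \<sigma> *\<^sub>R Gy u v)"
  have "norm (p - q) \<le> norm ((v + \<sigma> *\<^sub>R (Gy u v - \<mu> *\<^sub>R (v - y0))) - (v + \<sigma> *\<^sub>R Gy u v))"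
    unfolding p_def q_def dist_norm[symmetric]
    using y0 by (intro closest_point_lipschitz convex_Y compact_imp_closed compact_Y) auto
  also have "\<dots> = \<sigma> * \<mu> * norm (v - y0)"
    using \<sigma> mu by (simp add: algebra_simps flip: scaleR_diff_right)
  also have "\<dots> \<le> \<sigma> * \<mu> * diameter Y" using \<sigma> mu by (intro mult_left_mono Y_diameter v y0) simp
  finally have "norm (p - q) \<le> \<sigma> * \<mu> * diameter Y" .
  moreover have "norm (p - ystar u) \<le> (1 - \<sigma> * \<mu>) * norm (v - ystar u)"
    unfolding p_def by (rule dual_step_contraction[OF u v \<sigma>])
  moreover have "norm (v - q) \<le> norm (v - ystar u) + norm (p - ystar u) + norm (p - q)"
    using norm_triangle_ineq[of "v - p" "p - q"] norm_triangle_ineq4[of "v - ystar u" "p - ystar u"] by simp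
  ultimately have "norm (v - q) \<le> (2 - \<sigma> * \<mu>) * norm (v - ystar u) + \<sigma> * \<mu> * diameter Y"
    by (simp add: algebra_simps)
  then show ?thesis using \<sigma> by (simp add: gap_Y_def q_def field_simps)
qed

end

section \<open>Convergence bounds for both gaps\<close>

lemma gap_X_eq:
  assumes "is_arg_min (blinfun_apply (Gx u v)) (\<lambda>z. z \<in> X) s"
  shows "gap_X X Gx u v = Gx u v (u - s)"
  unfolding gap_X_def using assms
  by (intro cSup_eq_maximum) (auto simp: is_arg_min_linorder blinfun.diff_right)

theorem theorem5p1:
  fixes X :: "'a::real_normed_vector set" and Y :: "'b::euclidean_space set"
    and L :: "'a \<Rightarrow> 'b \<Rightarrow> real"
    and Gx :: "'a \<Rightarrow> 'b \<Rightarrow> ('a \<Rightarrow>\<^sub>L real)" and Gy :: "'a \<Rightarrow> 'b \<Rightarrow> 'b"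
    and Lxx Lyx Lyy \<mu> \<tau> \<sigma> \<rho> :: real
    and x :: "nat \<Rightarrow> 'a" and y :: "nat \<Rightarrow> 'b" and K :: nat
  assumes fin_dim: "\<exists>B :: 'a set. finite B \<and> span B = UNIV"
    and X: "convex X" "compact X"
    and Y: "convex Y" "compact Y"
    and const_bounds: "Lxx \<ge> 0" "Lyx > 0" "Lyy \<ge> 0"
    and grad_x: "is_grad_x X Y L Gx"
    and grad_x_cont: "\<And>v. v \<in> Y \<Longrightarrow> continuous_on X (\<lambda>u. Gx u v)"
    and grad_x_lipschitz:
      "\<And>u u' v v'. u \<in> X \<Longrightarrow> u' \<in> X \<Longrightarrow> v \<in> Y \<Longrightarrow> v' \<in> Y \<Longrightarrow>
         norm (Gx u v - Gx u' v') \<le> Lxx * norm (u - u') + Lyx * norm (v - v')"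
    and concave: "\<And>u. u \<in> X \<Longrightarrow> concave_on Y (L u)"
    and grad_y: "is_grad_y X Y L Gy"
    and grad_y_cont: "\<And>u. u \<in> X \<Longrightarrow> continuous_on Y (Gy u)"
    and grad_y_lipschitz:
      "\<And>u u' v v'. u \<in> X \<Longrightarrow> u' \<in> X \<Longrightarrow> v \<in> Y \<Longrightarrow> v' \<in> Y \<Longrightarrow>
         norm (Gy u v - Gy u' v') \<le> Lyx * norm (u - u') + Lyy * norm (v - v')"
    and mu: "\<mu> > 0"
    and tau: "0 < \<tau>" "\<tau> \<le> 1"
    and sigma: "0 < \<sigma>" "\<sigma> \<le> 2 / (Lyy + 2 * \<mu>)"
    and rho: "\<rho> = max \<bar>1 - \<sigma> * (Lyy + \<mu>)\<bar> \<bar>1 - \<sigma> * \<mu>\<bar>"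
    and alg: "cg_rpga X Y Gx Gy \<mu> (\<lambda>_. \<tau>) (\<lambda>_. \<sigma>) x y"
    and K: "K \<ge> 1"
  shows "\<exists>t \<in> {K div 2 .. K - 1}.
      x t \<in> X \<and> y t \<in> Y \<and>
      gap_X X Gx (x t) (y t)
        \<le> 2 * (primal_value Y L (x 0) - primal_value Y L (x K)) / (\<tau> * real K)
          + \<mu> / (\<tau> * real K) * (diameter Y)\<^sup>2
          + 2 * Lyx / ((1 - \<rho>) * real K) * diameter X * norm (y 0 - reg_argmax Y L \<mu> (y 0) (x 0))
          + (2 * Lyx\<^sup>2 / (\<mu> * (1 - \<rho>)) + Lxx + Lyx\<^sup>2 / \<mu>) * \<tau> * (diameter X)\<^sup>2 \<and>
      gap_Y Y Gy \<sigma> (x t) (y t)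
        \<le> 2 * \<rho> ^ (K div 2) / \<sigma> * norm (y 0 - reg_argmax Y L \<mu> (y 0) (x 0))
          + 2 * Lyx * \<rho> / (\<sigma> * \<mu> * (1 - \<rho>)) * \<tau> * diameter X
          + Lyx / (\<sigma> * \<mu>) * \<tau> * diameter X
          + \<mu> * diameter Y"
proof -
  interpret regularized_saddle X Y L Gx Gy Lxx Lyx Lyy \<mu> "y 0"
    using assms by unfold_locales (auto simp: cg_rpga_def)
  obtain s where x0: "x 0 \<in> X"
    and s: "\<And>k. is_arg_min (blinfun_apply (Gx (x k) (y k))) (\<lambda>z. z \<in> X) (s k)"
    and x_step: "\<And>k. x (Suc k) = \<tau> *\<^sub>R s k + (1 - \<tau>) *\<^sub>R x k"
    and y_step: "\<And>k. y (Suc k) = closest_point Y (y k + \<sigma> *\<^sub>R (Gy (x k) (y k) - \<mu> *\<^sub>R (y k - y 0)))"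
    using alg by (auto simp: cg_rpga_def)
  have s_in: "s k \<in> X" for k using s[of k] by (simp add: is_arg_min_def)
  define d where "d k = \<tau> *\<^sub>R (s k - x k)" for k
  have x_Suc: "x (Suc k) = x k + d k" for k by (simp add: x_step d_def algebra_simps)
  have x_in: "x k \<in> X" for k
  proof (induction k)
    case (Suc k)
    then show ?case using convexD_alt[OF X(1) Suc s_in[of k], of \<tau>] tau by (simp add: x_step add.commute)
  qed (rule x0)
  have y_in: "y k \<in> Y" for k by (cases k) (simp_all add: y0 y_step closest_point_mem)

  have \<sigma>_le: "\<sigma> * (Lyy + 2 * \<mu>) \<le> 2"
    using sigma(2) const_bounds(3) mu by (simp add: pos_le_divide_eq)
  \<comment> \<open>The step-size bound says \<sigma> (Lyy + \<mu>) - 1 \<le> 1 - \<sigma> \<mu>,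
    and Lyy \<ge> 0 gives the other sign, so the second entry of the maximum wins.\<close>
  have "0 \<le> \<sigma> * Lyy" "0 < \<sigma> * \<mu>" using sigma const_bounds mu by auto
  then have \<rho>: "\<rho> = 1 - \<sigma> * \<mu>" "0 \<le> \<rho>" "\<rho> < 1"
    using \<sigma>_le by (auto simp: rho algebra_simps)

  define D where "D = diameter X"
  \<comment> \<open>The drift of the dual maximizer in one primal step of length at most \<tau>
    D.\<close>
  define c where "c = Lyx / \<mu> * (\<tau> * D)"
  define \<delta> where "\<delta> k = norm (y k - ystar (x k))" for k
  have D: "0 \<le> D" unfolding D_def by (intro diameter_ge_0 compact_imp_bounded X)
  have d_le: "norm (d k) \<le> \<tau> * D" for k
    using diameter_bounded_bound[OF compact_imp_bounded[OF X(2)] s_in[of k] x_in[of k]] tau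
    by (simp add: d_def D_def dist_norm)
  have \<delta>_Suc: "\<delta> (Suc k) \<le> \<rho> * \<delta> k + c" for k
  proof -
    have "norm (ystar (x k) - ystar (x (Suc k))) \<le> Lyx / \<mu> * norm (d k)"
      using ystar_lipschitz[OF x_in x_in, of k "Suc k"] by (simp add: x_Suc)
    also have "\<dots> \<le> c"
      unfolding c_def using const_bounds mu by (intro mult_left_mono d_le) auto
    finally have "norm (ystar (x k) - ystar (x (Suc k))) \<le> c" .
    moreover have "norm (y (Suc k) - ystar (x k)) \<le> \<rho> * \<delta> k"
      unfolding y_step \<rho>(1) \<delta>_def by (rule dual_step_contraction[OF x_in y_in sigma(1) \<sigma>_le])
    ultimately show ?thesis
      using norm_triangle_ineq[of "y (Suc k) - ystar (x k)" "ystar (x k) - ystar (x (Suc k))"]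
      by (simp add: \<delta>_def)
  qed
  have \<delta>_le: "\<delta> k \<le> \<rho> ^ k * \<delta> 0 + c / (1 - \<rho>)" for k
  proof (induction k)
    case 0
    have "0 \<le> c" using const_bounds mu tau D by (simp add: c_def)
    then show ?case using \<rho> by simp
  next
    case (Suc k)
    have "\<delta> (Suc k) \<le> \<rho> * (\<rho> ^ k * \<delta> 0 + c / (1 - \<rho>)) + c"
      using \<delta>_Suc[of k] mult_left_mono[OF Suc \<rho>(2)] by simp
    also have "\<dots> = \<rho> ^ Suc k * \<delta> 0 + c / (1 - \<rho>)" using \<rho> by (simp add: field_simps)
    finally show ?case .
  qed
  \<comment> \<open>Summing the recursion directly avoids the geometric series; keeping \<delta> n
    on the left makes the induction close.\<close>
  have "(1 - \<rho>) * (\<Sum>k<n. \<delta> k) + \<delta> n \<le> \<delta> 0 + real n * c" for n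
  proof (induction n)
    case (Suc n)
    then show ?case using \<delta>_Suc[of n] by (simp add: algebra_simps)
  qed simp
  from this[of K] have "(1 - \<rho>) * (\<Sum>k<K. \<delta> k) \<le> \<delta> 0 + real K * c"
    using norm_ge_zero[of "y K - ystar (x K)"] unfolding \<delta>_def by linarith
  then have \<delta>_sum: "(\<Sum>k<K. \<delta> k) \<le> (\<delta> 0 + real K * c) / (1 - \<rho>)"
    using \<rho> by (simp add: pos_le_divide_eq mult.commute)

  define G where "G k = gap_X X Gx (x k) (y k)" for k
  define F where "F k = reg (x k) (ystar (x k))" for k
  define M where "M = (Lxx + Lyx\<^sup>2 / \<mu>) / 2 * (\<tau> * D)\<^sup>2"
  have G_eq: "G k = Gx (x k) (y k) (x k - s k)" for k
    unfolding G_def by (rule gap_X_eq[of Gx]) (rule s)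
  have G_nonneg: "0 \<le> G k" for k
    using s[of k] x_in[of k] unfolding G_eq by (auto simp: is_arg_min_linorder blinfun.diff_right)
  have descent: "\<tau> * G k \<le> F k - F (Suc k) + Lyx * (\<tau> * D) * \<delta> k + M" for k
  proof -
    have "F (Suc k) - F k \<le> Gx (x k) (y k) (d k) + Lyx * \<delta> k * norm (d k) + (Lxx + Lyx\<^sup>2 / \<mu>) / 2 * (norm (d k))\<^sup>2"
      using reg_value_increment_le[of "x k" "d k" "y k"] x_in[of k] x_in[of "Suc k"] y_in
      by (simp add: F_def \<delta>_def x_Suc)
    also have "Gx (x k) (y k) (d k) = - (\<tau> * G k)"
      by (simp add: G_eq d_def blinfun.scaleR_right blinfun.diff_right algebra_simps)
    also have "Lyx * \<delta> k * norm (d k) \<le> Lyx * \<delta> k * (\<tau> * D)"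
      using const_bounds by (intro mult_left_mono d_le) (simp add: \<delta>_def)
    also have "(Lxx + Lyx\<^sup>2 / \<mu>) / 2 * (norm (d k))\<^sup>2 \<le> M"
      unfolding M_def using const_bounds mu by (intro mult_left_mono power_mono d_le) auto
    finally show ?thesis by (simp add: algebra_simps)
  qed

  \<comment> \<open>Rounding K / 2 down keeps the range nonempty for K = 1 and leaves at least K / 2
    indices.\<close>
  let ?I = "{K div 2..<K}"
  have "?I \<noteq> {}" using K by simp
  \<comment> \<open>The choice looks at the primal gap alone: the dual bound below holds for every
    index from \<open>K div 2\<close> on, because \<rho> ^ t decreases in t.\<close>
  then obtain t where t: "t \<in> ?I" and t_min: "\<And>k. k \<in> ?I \<Longrightarrow> G t \<le> G k"
    using ex_is_arg_min_if_finite[of ?I G] by (auto simp: is_arg_min_linorder)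

  have "K \<le> 2 * card ?I" by simp
  then have "real K / 2 \<le> real (card ?I)" by linarith
  then have "real K / 2 * G t \<le> real (card ?I) * G t"
    by (intro mult_right_mono G_nonneg)
  also have "\<dots> \<le> (\<Sum>k\<in>?I. G k)" by (rule sum_bounded_below) (rule t_min)
  also have "\<dots> \<le> (\<Sum>k<K. G k)" by (intro sum_mono2 G_nonneg) auto
  finally have "\<tau> * (real K / 2 * G t) \<le> \<tau> * (\<Sum>k<K. G k)"
    using tau by simp
  also have "\<dots> \<le> (\<Sum>k<K. F k - F (Suc k) + Lyx * (\<tau> * D) * \<delta> k + M)"
    unfolding sum_distrib_left by (intro sum_mono descent)
  also have "\<dots> = F 0 - F K + Lyx * (\<tau> * D) * (\<Sum>k<K. \<delta> k) + real K * M"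
    by (simp add: sum.distrib sum_distrib_left sum_lessThan_telescope')
  also have "\<dots> \<le> (primal_value Y L (x 0) - primal_value Y L (x K) + \<mu> / 2 * (diameter Y)\<^sup>2)
      + Lyx * (\<tau> * D) * ((\<delta> 0 + real K * c) / (1 - \<rho>)) + real K * M"
    using reg_value_le_primal_value[OF x_in[of 0]] primal_value_le_reg_value[OF x_in[of K]]
      mult_left_mono[OF \<delta>_sum, of "Lyx * (\<tau> * D)"] const_bounds tau D
    by (simp add: F_def)
  finally have "G t \<le> ((primal_value Y L (x 0) - primal_value Y L (x K) + \<mu> / 2 * (diameter Y)\<^sup>2)
      + Lyx * (\<tau> * D) * ((\<delta> 0 + real K * c) / (1 - \<rho>)) + real K * M) / (\<tau> * (real K / 2))"
    using tau K by (simp add: pos_le_divide_eq mult_ac)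
  \<comment> \<open>The summand 2 Lyx^2 / (\<mu> (1 - \<rho>)) is the accumulated drift c / (1 -
    \<rho>). It carries no factor \<rho>, since in \<open>\<delta>_Suc\<close> the drift is added
    after the contraction.\<close>
  also have "\<dots> = 2 * (primal_value Y L (x 0) - primal_value Y L (x K)) / (\<tau> * real K)
      + \<mu> / (\<tau> * real K) * (diameter Y)\<^sup>2
      + 2 * Lyx / ((1 - \<rho>) * real K) * D * \<delta> 0
      + (2 * Lyx\<^sup>2 / (\<mu> * (1 - \<rho>)) + Lxx + Lyx\<^sup>2 / \<mu>) * \<tau> * D\<^sup>2"
  proof -
    define r where "r = 1 - \<rho>"
    have "\<tau> \<noteq> 0" "real K \<noteq> 0" "r \<noteq> 0" "\<mu> \<noteq> 0" using tau K \<rho> mu by (auto simp: r_def)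
    then show ?thesis
      unfolding M_def c_def r_def[symmetric] by (simp add: field_simps power2_eq_square)
  qed
  finally have gap_x: "gap_X X Gx (x t) (y t) \<le> \<dots>" by (simp add: G_def)

  have "gap_Y Y Gy \<sigma> (x t) (y t) \<le> (1 + \<rho>) / \<sigma> * \<delta> t + \<mu> * diameter Y"
    using gap_Y_le[OF x_in y_in sigma(1) \<sigma>_le] by (simp add: \<rho>(1) \<delta>_def)
  also have "(1 + \<rho>) / \<sigma> * \<delta> t \<le> (1 + \<rho>) / \<sigma> * (\<rho> ^ t * \<delta> 0 + c / (1 - \<rho>))"
    using \<rho> sigma by (intro mult_left_mono \<delta>_le) auto
  also have "\<dots> = (1 + \<rho>) * \<rho> ^ t / \<sigma> * \<delta> 0 + (1 + \<rho>) / \<sigma> * (c / (1 - \<rho>))"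
    by (simp add: algebra_simps)
  also have "(1 + \<rho>) * \<rho> ^ t / \<sigma> * \<delta> 0 \<le> 2 * \<rho> ^ (K div 2) / \<sigma> * \<delta> 0"
    using \<rho> sigma t by (intro mult_right_mono divide_right_mono mult_mono power_decreasing) (auto simp: \<delta>_def)
  \<comment> \<open>Splitting (1 + \<rho>) / (1 - \<rho>) = 2 \<rho> / (1 - \<rho>) + 1 produces the
    two drift terms of the dual bound.\<close>
  also have "(1 + \<rho>) / \<sigma> * (c / (1 - \<rho>))
      = 2 * Lyx * \<rho> / (\<sigma> * \<mu> * (1 - \<rho>)) * \<tau> * D + Lyx / (\<sigma> * \<mu>) * \<tau> * D"
  proof -
    define r where "r = 1 - \<rho>"
    have "r \<noteq> 0" "\<rho> = 1 - r" using \<rho>(3) by (simp_all add: r_def)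
    then show ?thesis using sigma mu by (simp add: c_def field_simps)
  qed
  finally have gap_y: "gap_Y Y Gy \<sigma> (x t) (y t) \<le> 2 * \<rho> ^ (K div 2) / \<sigma> * \<delta> 0
      + 2 * Lyx * \<rho> / (\<sigma> * \<mu> * (1 - \<rho>)) * \<tau> * D + Lyx / (\<sigma> * \<mu>) * \<tau> * D + \<mu> * diameter Y"
    by (simp add: add.assoc)

  have "t \<in> {K div 2 .. K - 1}" using t by auto
  then show ?thesis using gap_x gap_y x_in y_in unfolding \<delta>_def D_def by blast
qed

end
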